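(* Let $r_0>0$ and let $f:[r_0,\infty)\to\mathbb{R}$ be a locally integrable function on $[r_0,\infty)$. If the improper integral $\int_{r_0}^{\infty}f(t)\,dt$ converges (to a finite value), then for any $\psi\in\mathcal{D}(r_0,\infty)$ we have $$\lim_{r\to\infty}\frac{1}{\psi(r)}\int_{r_0}^{r}\psi(t)f(t)\,dt=0 .$$ Moreover, if $\int_{r_0}^{\infty}|f(t)|\,dt<\infty$, then for any $\psi\in\mathcal{D}(r_0,\infty)$ the function $\dfrac{\psi(r)}{\psi'(r)}f(r)$ has limit $0$ in $\psi$-density as $r\to\infty$.
   Context: $\mathcal{D}(r_0,\infty)$ denotes the class of positive, unbounded, differentiable and strictly increasing functions on $(r_0,\infty)$. For $\psi\in\mathcal{D}(r_0,\infty)$, a measurable set $E\subset(r_0,\infty)$ has zero $\psi$-density if $$\limsup_{r\to\infty}\frac{1}{\psi(r)}\int_{E\cap[r_0,r)}\psi'(t)\,dt=0 .$$ A function $g$ on $(r_0,\infty)$ has the limit $l\in\mathbb{R}$ in $\psi$-density as $r\to\infty$ if for every $\varepsilon>0$ the set $\{r\in(r_0,\infty):|g(r)-l|\ge\varepsilon\}$ has zero $\psi$-density. The quotient $\frac{\psi(r)}{\psi'(r)}f(r)$ is considered at points where $\psi'(r)\neq0$; the set where $\psi'(r)=0$ contributes $0$ to the integrals defining $\psi$-density, so the values assigned there are irrelevant. *)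

theory Defs
  imports "HOL-Analysis.Analysis"
begin

definition locally_integrable_on :: "(real \<Rightarrow> real) \<Rightarrow> real set \<Rightarrow> bool"
    (infix "locally'_integrable'_on" 46) where
  "f locally_integrable_on S \<longleftrightarrow>
     (\<forall>K. compact K \<and> K \<subseteq> S \<longrightarrow> set_integrable lebesgue K f)"

text \<open>Elements of the class are total functions; only their values on the open
  half-line \<open>(r0, \<infinity>)\<close> matter.\<close>

definition density_class :: "real \<Rightarrow> (real \<Rightarrow> real) set" where
  "density_class r0 =
     {\<psi>. (\<forall>r\<in>{r0<..}. \<psi> r > 0) \<and> \<not> bounded (\<psi> ` {r0<..}) \<and>
          \<psi> differentiable_on {r0<..} \<and> strict_mono_on {r0<..} \<psi>}"

text \<open>For \<open>\<psi>\<close> in the class, \<open>deriv \<psi>\<close> is nonnegative and integrable on \<open>(r0, r)\<close>, so the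
  Bochner integral below never takes its default value. Points where \<open>deriv \<psi>\<close> vanishes
  contribute nothing, so the convention \<open>x / 0 = 0\<close> is harmless for quotients by \<open>deriv \<psi>\<close>.\<close>

definition zero_density :: "real \<Rightarrow> (real \<Rightarrow> real) \<Rightarrow> real set \<Rightarrow> bool" where
  "zero_density r0 \<psi> E \<longleftrightarrow>
     E \<subseteq> {r0<..} \<and> E \<in> sets lebesgue \<and>
     Limsup at_top
       (\<lambda>r. ereal (1 / \<psi> r * (LINT t:E \<inter> {r0..<r}|lebesgue. deriv \<psi> t))) = 0"

definition has_limit_in_density ::
    "real \<Rightarrow> (real \<Rightarrow> real) \<Rightarrow> (real \<Rightarrow> real) \<Rightarrow> real \<Rightarrow> bool" where
  "has_limit_in_density r0 \<psi> g l \<longleftrightarrow>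
     (\<forall>\<epsilon>>0. zero_density r0 \<psi> {r \<in> {r0<..}. \<bar>g r - l\<bar> \<ge> \<epsilon>})"

end

theory Submission
  imports Defs
begin

text \<open>By the second mean value theorem, for \<open>R \<le> r\<close> there is \<open>c\<close> between them with
  \<open>\<integral>\<^sub>R\<^sup>r \<psi> f = \<psi>(R) \<integral>\<^sub>R\<^sup>c f + \<psi>(r) \<integral>\<^sub>c\<^sup>r f\<close>. Both integrals of \<open>f\<close> are small for large \<open>R\<close>
  by the Cauchy criterion, and \<open>\<psi>(R) \<le> \<psi>(r)\<close>; the part over \<open>[r\<^sub>0, R]\<close> is a constant that is
  negligible against \<open>\<psi>(r) \<rightarrow> \<infinity>\<close>. For the second claim, \<open>\<psi>' \<le> \<psi> |f| / \<epsilon>\<close> on the exceptional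
  set, so the first claim applied to \<open>|f|\<close> bounds its \<open>\<psi>\<close>-density.\<close>

section \<open>Means against an increasing weight\<close>

lemma increasing_weight_mean_tendsto_0:
  fixes f g :: "real \<Rightarrow> real"
  assumes f: "\<And>b. f integrable_on {a..b}"
    and lim: "((\<lambda>b. integral {a..b} f) \<longlongrightarrow> L) at_top"
    and g: "mono g" and g0: "\<And>x. 0 \<le> g x" and ginf: "filterlim g at_top at_top"
  shows "((\<lambda>r. 1 / g r * integral {a..r} (\<lambda>t. g t * f t)) \<longlongrightarrow> 0) at_top"
proof (rule tendstoI)
  fix e :: real assume e: "0 < e"
  define F where "F = (\<lambda>b. integral {a..b} f)"
  \<comment> \<open>The full second mean value theorem yields a \<open>has_integral\<close> fact, so
    it also gives gauge integrability of the product. For \<open>b < a\<close> the interval is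
    empty.\<close>
  have gf: "(\<lambda>t. g t * f t) integrable_on {a..b}" for b
  proof (cases "a \<le> b")
    case True
    then show ?thesis
      using second_mean_value_theorem_full[OF f[of b] True, of g] monoD[OF g]
      by (metis integrable_on_def)
  qed auto
  \<comment> \<open>Two values within \<open>e / 8\<close> of \<open>L\<close> differ by at most
    \<open>e / 4\<close>. The head \<open>K\<close> and the two mean value terms will each cost at
    most \<open>e / 4 * g r\<close>, which leaves room below \<open>e * g r\<close>.\<close>
  have "\<forall>\<^sub>F x in at_top. dist (F x) L < e / 8"
    unfolding F_def using lim e by (intro tendstoD) auto
  then obtain R0 where R0: "\<And>x. x \<ge> R0 \<Longrightarrow> \<bar>F x - L\<bar> < e / 8"
    by (auto simp: eventually_at_top_linorder dist_real_def)
  define R where "R = max a R0"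
  define K where "K = integral {a..R} (\<lambda>t. g t * f t)"
  have F_diff: "integral {x..y} f = F y - F x" if "a \<le> x" "x \<le> y" for x y
    using Henstock_Kurzweil_Integration.integral_combine[OF that f] by (simp add: F_def)
  have small: "\<bar>F x - F y\<bar> \<le> e / 4" if "R \<le> x" "R \<le> y" for x y
    using R0[of x] R0[of y] that unfolding R_def by linarith
  \<comment> \<open>This threshold makes the fixed head \<open>K\<close> smaller than
    \<open>e / 4 * g r\<close> and also forces \<open>g r > 0\<close>.\<close>
  have "\<forall>\<^sub>F r in at_top. g r > 4 / e * \<bar>K\<bar>"
    using ginf filterlim_at_top_dense by blast
  then show "\<forall>\<^sub>F r in at_top. dist (1 / g r * integral {a..r} (\<lambda>t. g t * f t)) 0 < e"
    using eventually_ge_at_top[of R]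
  proof eventually_elim
    case (elim r)
    have aR: "a \<le> R" by (simp add: R_def)
    have "0 \<le> 4 / e * \<bar>K\<bar>" using e by simp
    then have gr: "g r > 0" using elim by linarith
    have K: "\<bar>K\<bar> < e / 4 * g r"
      using elim e by (simp add: field_simps)
    have fR: "f integrable_on {R..r}"
      using integrable_subinterval_real[OF f[of r]] aR by auto
    obtain c where c: "R \<le> c" "c \<le> r"
      and eq: "integral {R..r} (\<lambda>t. g t * f t) = g R * integral {R..c} f + g r * integral {c..r} f"
      using second_mean_value_theorem[OF fR elim(2), of g] monoD[OF g]
      by (metis atLeastAtMost_iff)
    have "\<bar>g R * integral {R..c} f\<bar> \<le> g r * (e / 4)"
      unfolding F_diff[OF aR c(1)] abs_mult
      using monoD[OF g elim(2)] g0 small[of c R] c by (intro mult_mono) auto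
    moreover have "\<bar>g r * integral {c..r} f\<bar> \<le> g r * (e / 4)"
      unfolding F_diff[OF order.trans[OF aR c(1)] c(2)] abs_mult
      using g0 small[of r c] c by (intro mult_mono) auto
    moreover have "integral {a..r} (\<lambda>t. g t * f t) = K + integral {R..r} (\<lambda>t. g t * f t)"
      using Henstock_Kurzweil_Integration.integral_combine[OF aR elim(2) gf] by (simp add: K_def)
    ultimately have "\<bar>integral {a..r} (\<lambda>t. g t * f t)\<bar> < e / 4 * g r + 2 * (g r * (e / 4))"
      using K eq by linarith
    also have "\<dots> \<le> e * g r" using e gr by (simp add: field_simps)
    finally show ?case
      using gr by (simp add: dist_real_def abs_mult field_simps)
  qed
qed

section \<open>Weights from the density class\<close>

lemma density_class_mono:
  assumes "\<psi> \<in> density_class r0" "r0 < x" "x \<le> y"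
  shows "\<psi> x \<le> \<psi> y"
proof -
  have "mono_on {r0<..} \<psi>"
    using assms(1) by (simp add: density_class_def strict_mono_on_imp_mono_on)
  then show ?thesis
    by (rule mono_onD) (use assms in auto)
qed

text \<open>Positivity turns unboundedness into unboundedness above, and monotonicity keeps every
  later value above one that exceeds \<open>Z\<close>.\<close>

lemma filterlim_at_top_density_class:
  assumes "\<psi> \<in> density_class r0"
  shows "filterlim \<psi> at_top at_top"
proof -
  have pos: "\<And>r. r > r0 \<Longrightarrow> \<psi> r > 0" and unb: "\<not> bounded (\<psi> ` {r0<..})"
    and mono: "\<And>x y. r0 < x \<Longrightarrow> x \<le> y \<Longrightarrow> \<psi> x \<le> \<psi> y"
    using assms density_class_mono[OF assms] by (auto simp: density_class_def)
  show ?thesis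
    unfolding filterlim_at_top
  proof
    fix Z
    obtain x where "r0 < x" "Z < \<psi> x"
      using unb pos unfolding bounded_real
      by (smt (verit, best) greaterThan_iff imageE)
    then have "\<forall>r\<ge>x. Z \<le> \<psi> r"
      using mono by fastforce
    then show "\<forall>\<^sub>F r in at_top. Z \<le> \<psi> r"
      by (auto simp: eventually_at_top_linorder)
  qed
qed

text \<open>Carries the mean value result from gauge integrals to Lebesgue integrals. The
  integrability conclusion shows that the weighted integral is not a default value; it later
  supplies an integrable majorant.\<close>

lemma density_class_weighted_integral:
  assumes \<psi>: "\<psi> \<in> density_class r0" and f: "f locally_integrable_on {r0..}"
  shows "set_integrable lebesgue {r0<..r} (\<lambda>t. \<psi> t * f t)"
    and "((\<lambda>R. LINT t:{r0..R}|lebesgue. f t) \<longlongrightarrow> L) at_top \<Longrightarrow>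
      ((\<lambda>r. 1 / \<psi> r * (LINT t:{r0<..r}|lebesgue. \<psi> t * f t)) \<longlongrightarrow> 0) at_top"
proof -
  \<comment> \<open>\<open>\<psi>\<close> is arbitrary up to and including \<open>r0\<close>.
    Setting it to 0 there gives a weight that is monotone and nonnegative on the whole line, hence
    Borel measurable and bounded on each \<open>{r0..b}\<close>.\<close>
  define g where "g t = (if t \<le> r0 then 0 else \<psi> t)" for t
  have pos: "\<And>r. r > r0 \<Longrightarrow> \<psi> r > 0"
    and mono: "\<And>x y. r0 < x \<Longrightarrow> x \<le> y \<Longrightarrow> \<psi> x \<le> \<psi> y"
    using \<psi> density_class_mono[OF \<psi>] by (auto simp: density_class_def)
  have g: "mono g" "\<And>x. 0 \<le> g x"
    using pos mono by (force simp: g_def mono_def less_imp_le)+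
  have f': "f absolutely_integrable_on {r0..b}" for b
    using f by (auto simp: locally_integrable_on_def)
  have gf: "(\<lambda>t. g t * f t) absolutely_integrable_on {r0..b}" for b
  proof (rule absolutely_integrable_bounded_measurable_product_real[OF _ _ _ f'])
    show "g \<in> borel_measurable (lebesgue_on {r0..b})"
      using borel_measurable_mono[OF g(1)]
      by (simp add: measurable_completion measurable_restrict_space1)
    have "norm (g x) \<le> g b" if "x \<in> {r0..b}" for x
      using g that by (auto dest: monoD)
    then show "bounded (g ` {r0..b})"
      unfolding bounded_iff by blast
  qed auto
  \<comment> \<open>At \<open>t = r0\<close> the left side vanishes by the open endpoint and the
    right side because \<open>g r0 = 0\<close>.\<close>
  have eq: "indicator {r0<..b} t *\<^sub>R (\<psi> t * f t) = indicator {r0..b} t *\<^sub>R (g t * f t)" for b t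
    by (auto simp: g_def indicator_def)
  show "set_integrable lebesgue {r0<..r} (\<lambda>t. \<psi> t * f t)"
    using gf[of r] unfolding set_integrable_def eq .
  have ev: "\<forall>\<^sub>F r in at_top. g r = \<psi> r"
    using eventually_gt_at_top[of r0] by eventually_elim (auto simp: g_def)
  assume "((\<lambda>R. LINT t:{r0..R}|lebesgue. f t) \<longlongrightarrow> L) at_top"
  then have "((\<lambda>R. integral {r0..R} f) \<longlongrightarrow> L) at_top"
    by (simp add: set_lebesgue_integral_eq_integral(2)[OF f'])
  then have *: "((\<lambda>r. 1 / g r * integral {r0..r} (\<lambda>t. g t * f t)) \<longlongrightarrow> 0) at_top"
    using filterlim_at_top_density_class[OF \<psi>] filterlim_cong[OF refl refl ev] g
      set_lebesgue_integral_eq_integral(1)[OF f']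
    by (intro increasing_weight_mean_tendsto_0) auto
  have "\<forall>\<^sub>F r in at_top. 1 / g r * integral {r0..r} (\<lambda>t. g t * f t)
      = 1 / \<psi> r * (LINT t:{r0<..r}|lebesgue. \<psi> t * f t)"
    using ev
  proof eventually_elim
    case (elim r)
    have "(LINT t:{r0<..r}|lebesgue. \<psi> t * f t) = (LINT t:{r0..r}|lebesgue. g t * f t)"
      unfolding set_lebesgue_integral_def eq ..
    then show ?case
      using elim by (simp add: set_lebesgue_integral_eq_integral(2)[OF gf])
  qed
  then show "((\<lambda>r. 1 / \<psi> r * (LINT t:{r0<..r}|lebesgue. \<psi> t * f t)) \<longlongrightarrow> 0) at_top"
    using * by (rule Lim_transform_eventually[rotated])
qed

section \<open>Measurability of the function and of the derivative\<close>

text \<open>The cutoffs of \<open>f\<close> to the compact intervals \<open>{a..real n}\<close> are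
  integrable, hence measurable, and at each point they eventually equal the cutoff to the
  half-line.\<close>

lemma borel_measurable_locally_integrable:
  assumes "f locally_integrable_on {a..}"
  shows "f \<in> borel_measurable (lebesgue_on {a..})"
proof -
  have "(\<lambda>x. indicator {a..} x *\<^sub>R f x) \<in> borel_measurable lebesgue"
  proof (rule borel_measurable_LIMSEQ_metric)
    show "(\<lambda>x. indicator {a..real n} x *\<^sub>R f x) \<in> borel_measurable lebesgue" for n
      using assms unfolding locally_integrable_on_def set_integrable_def
      by (intro borel_measurable_integrable) auto
    show "(\<lambda>n. indicator {a..real n} x *\<^sub>R f x) \<longlonglongrightarrow> indicator {a..} x *\<^sub>R f x" for x
    proof (rule tendsto_eventually)
      show "\<forall>\<^sub>F n in sequentially. indicator {a..real n} x *\<^sub>R f x = indicator {a..} x *\<^sub>R f x"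
        using eventually_ge_at_top[of "nat \<lceil>x\<rceil>"]
      proof eventually_elim
        case (elim n)
        then have "x \<le> real n" by linarith
        then show ?case by (auto simp: indicator_def)
      qed
    qed
  qed
  then show ?thesis
    by (subst borel_measurable_restrict_space_iff) auto
qed

text \<open>The derivative is the pointwise limit of difference quotients with steps
  \<open>1 / real (Suc n)\<close>. These are continuous on the half-line, since a positive step
  never leaves it.\<close>

lemma borel_measurable_deriv:
  fixes f :: "real \<Rightarrow> real"
  assumes "f differentiable_on {a<..}"
  shows "deriv f \<in> borel_measurable (lebesgue_on {a<..})"
proof (rule borel_measurable_LIMSEQ_metric)
  have cont: "continuous_on {a<..} f"
    using assms by (rule differentiable_imp_continuous_on)
  show "(\<lambda>x. (f (x + 1 / real (Suc n)) - f x) / (1 / real (Suc n)))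
      \<in> borel_measurable (lebesgue_on {a<..})" for n
  proof (rule continuous_imp_measurable_on_sets_lebesgue)
    have "continuous_on {a<..} (\<lambda>x. f (x + 1 / real (Suc n)))"
      by (rule continuous_on_compose2[OF cont]) (auto intro!: continuous_intros elim!: less_trans)
    then show "continuous_on {a<..} (\<lambda>x. (f (x + 1 / real (Suc n)) - f x) / (1 / real (Suc n)))"
      by (intro continuous_intros cont) auto
  qed auto
  show "(\<lambda>n. (f (x + 1 / real (Suc n)) - f x) / (1 / real (Suc n))) \<longlonglongrightarrow> deriv f x"
    if "x \<in> space (lebesgue_on {a<..})" for x
  proof -
    have "x \<in> {a<..}" using that by simp
    then have "f differentiable at x"
      using assms differentiable_on_eq_differentiable_at open_greaterThan by blast
    then have "(\<lambda>h. (f (x + h) - f x) / h) \<midarrow>0\<rightarrow> deriv f x"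
      by (simp add: DERIV_deriv_iff_real_differentiable flip: DERIV_def)
    moreover have "filterlim (\<lambda>n. 1 / real (Suc n)) (at 0) sequentially"
      unfolding filterlim_at using LIMSEQ_Suc[OF lim_1_over_n[where 'a=real]] by simp
    ultimately show ?thesis
      by (rule filterlim_compose)
  qed
qed

lemma deriv_nonneg_mono_on:
  fixes f :: "real \<Rightarrow> real"
  assumes "mono_on S f" "open S" "x \<in> S" "f differentiable at x"
  shows "0 \<le> deriv f x"
  using assms mono_on_imp_deriv_nonneg[of S f "deriv f x" x]
  by (simp add: DERIV_deriv_iff_real_differentiable interior_open)

section \<open>Limit in density\<close>

lemma has_limit_in_density_0_if_integrable:
  assumes \<psi>: "\<psi> \<in> density_class r0" and f: "f locally_integrable_on {r0..}"
    and fin: "(\<integral>\<^sup>+t\<in>{r0..}. ennreal \<bar>f t\<bar> \<partial>lebesgue) < \<infinity>"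
  shows "has_limit_in_density r0 \<psi> (\<lambda>r. \<psi> r / deriv \<psi> r * f r) 0"
  unfolding has_limit_in_density_def
proof (intro allI impI)
  fix e :: real assume e: "0 < e"
  define E where "E = {r \<in> {r0<..}. e \<le> \<bar>\<psi> r / deriv \<psi> r * f r - 0\<bar>}"
  have pos: "\<And>r. r > r0 \<Longrightarrow> \<psi> r > 0" and diff: "\<psi> differentiable_on {r0<..}"
    and mono: "mono_on {r0<..} \<psi>"
    using \<psi> by (auto simp: density_class_def dest!: strict_mono_on_imp_mono_on)
  have deriv: "0 \<le> deriv \<psi> r" if "r > r0" for r
    using that diff by (intro deriv_nonneg_mono_on[OF mono]) (auto simp: differentiable_on_eq_differentiable_at)
  have f_meas: "f \<in> borel_measurable (lebesgue_on {r0..})"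
    using f by (rule borel_measurable_locally_integrable)
  have [measurable]: "f \<in> borel_measurable (lebesgue_on {r0<..})"
    by (rule measurable_restrict_mono[OF f_meas]) auto
  have [measurable]: "\<psi> \<in> borel_measurable (lebesgue_on {r0<..})"
    using differentiable_imp_continuous_on[OF diff]
    by (intro continuous_imp_measurable_on_sets_lebesgue) auto
  have \<psi>'_meas[measurable]: "deriv \<psi> \<in> borel_measurable (lebesgue_on {r0<..})"
    using diff by (rule borel_measurable_deriv)
  have "{r \<in> space (lebesgue_on {r0<..}). e \<le> \<bar>\<psi> r / deriv \<psi> r * f r - 0\<bar>}
      \<in> sets (lebesgue_on {r0<..})"
    by measurable
  then have E: "E \<in> sets lebesgue"
    by (simp add: E_def sets_restrict_space_iff)
  \<comment> \<open>Measurability and the finite nonnegative integral make \<open>f\<close>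
    integrable on the half-line. The truncated integrals of \<open>\<bar>f\<bar>\<close> therefore
    converge, as the first claim requires.\<close>
  have "set_integrable lebesgue {r0..} f"
    unfolding set_integrable_def
  proof (rule integrableI_bounded)
    show "(\<lambda>x. indicator {r0..} x *\<^sub>R f x) \<in> borel_measurable lebesgue"
      using f_meas by (subst (asm) borel_measurable_restrict_space_iff) auto
    have "(\<integral>\<^sup>+ x. ennreal (norm (indicator {r0..} x *\<^sub>R f x)) \<partial>lebesgue)
        = (\<integral>\<^sup>+t\<in>{r0..}. ennreal \<bar>f t\<bar> \<partial>lebesgue)"
      by (intro nn_integral_cong) (auto simp: indicator_def)
    then show "(\<integral>\<^sup>+ x. ennreal (norm (indicator {r0..} x *\<^sub>R f x)) \<partial>lebesgue) < \<infinity>"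
      using fin by simp
  qed
  then have "set_integrable lebesgue {r0..} (\<lambda>t. \<bar>f t\<bar>)"
    by (rule set_integrable_abs)
  then have lim: "((\<lambda>R. LINT t:{r0..R}|lebesgue. \<bar>f t\<bar>) \<longlongrightarrow> (LINT t:{r0..}|lebesgue. \<bar>f t\<bar>)) at_top"
    by (intro tendsto_set_lebesgue_integral_at_top) auto
  have abs_f: "(\<lambda>t. \<bar>f t\<bar>) locally_integrable_on {r0..}"
    using f by (auto simp: locally_integrable_on_def intro: set_integrable_abs)
  note abs = density_class_weighted_integral[OF \<psi> abs_f]
  define B where "B r = 1 / \<psi> r * (LINT t:{r0<..r}|lebesgue. \<psi> t * \<bar>f t\<bar>)" for r
  have "(B \<longlongrightarrow> 0) at_top"
    unfolding B_def using abs(2)[OF lim] .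
  then have B: "((\<lambda>r. B r / e) \<longlongrightarrow> 0) at_top"
    using e by (auto intro: tendsto_eq_intros)
  define D where "D r = 1 / \<psi> r * (LINT t:E \<inter> {r0..<r}|lebesgue. deriv \<psi> t)" for r
  have "\<bar>D r\<bar> \<le> B r / e" if r: "r > r0" for r
  proof -
    have bound: "0 \<le> indicator (E \<inter> {r0..<r}) t *\<^sub>R deriv \<psi> t"
      "indicator (E \<inter> {r0..<r}) t *\<^sub>R deriv \<psi> t \<le> (indicator {r0<..r} t *\<^sub>R (\<psi> t * \<bar>f t\<bar>)) / e" for t
    proof -
      \<comment> \<open>Where the derivative is 0, the convention \<open>x / 0 = 0\<close> makes the
        quotient 0, which is below \<open>e\<close>. So the derivative is positive on
        \<open>E\<close> and the division can be cleared.\<close>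
      have *: "deriv \<psi> t \<le> \<psi> t * \<bar>f t\<bar> / e" if "t \<in> E"
      proof -
        have t: "t > r0" "e \<le> \<bar>\<psi> t / deriv \<psi> t * f t\<bar>" using that by (auto simp: E_def)
        then have "deriv \<psi> t \<noteq> 0" using e by auto
        then have "deriv \<psi> t > 0" using deriv[OF t(1)] by simp
        then show ?thesis
          using t pos[OF t(1)] e by (simp add: abs_mult field_simps)
      qed
      show "0 \<le> indicator (E \<inter> {r0..<r}) t *\<^sub>R deriv \<psi> t"
        using deriv by (auto simp: indicator_def E_def)
      show "indicator (E \<inter> {r0..<r}) t *\<^sub>R deriv \<psi> t \<le> (indicator {r0<..r} t *\<^sub>R (\<psi> t * \<bar>f t\<bar>)) / e"
        using * pos e by (auto simp: indicator_def E_def less_imp_le)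
    qed
    have int: "integrable lebesgue (\<lambda>t. (indicator {r0<..r} t *\<^sub>R (\<psi> t * \<bar>f t\<bar>)) / e)"
      using abs(1)[of r] unfolding set_integrable_def by (rule integrable_divide)
    have nonneg: "0 \<le> (LINT t:E \<inter> {r0..<r}|lebesgue. deriv \<psi> t)"
      unfolding set_lebesgue_integral_def using bound(1) by (intro integral_nonneg_AE) auto
    \<comment> \<open>\<open>integral_mono'\<close> takes an integrable nonnegative majorant; a left
      integral that took the default value 0 would satisfy the bound as well.\<close>
    have "(LINT t:E \<inter> {r0..<r}|lebesgue. deriv \<psi> t)
        \<le> (LINT t|lebesgue. (indicator {r0<..r} t *\<^sub>R (\<psi> t * \<bar>f t\<bar>)) / e)"
      unfolding set_lebesgue_integral_def
      using bound order.trans[OF bound] by (intro integral_mono' int) auto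
    also have "\<dots> = (LINT t:{r0<..r}|lebesgue. \<psi> t * \<bar>f t\<bar>) / e"
      by (simp add: set_lebesgue_integral_def)
    finally show ?thesis
      using nonneg pos[OF r] by (simp add: D_def B_def abs_mult divide_right_mono field_simps)
  qed
  then have "(D \<longlongrightarrow> 0) at_top"
    by (intro Lim_null_comparison[OF _ B])
       (auto intro: eventually_mono[OF eventually_gt_at_top[of r0]])
  then have "((\<lambda>r. ereal (D r)) \<longlongrightarrow> 0) at_top"
    by (simp add: zero_ereal_def)
  then have "Limsup at_top (\<lambda>r. ereal (D r)) = 0"
    by (intro lim_imp_Limsup) auto
  then show "zero_density r0 \<psi> {r \<in> {r0<..}. e \<le> \<bar>\<psi> r / deriv \<psi> r * f r - 0\<bar>}"
    using E unfolding zero_density_def D_def E_def by auto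
qed

theorem theorem5p1:
  fixes r0 :: real and f :: "real \<Rightarrow> real"
  assumes "r0 > 0"
    and "f locally_integrable_on {r0..}"
  shows "((\<exists>L::real. ((\<lambda>R. LINT t:{r0..R}|lebesgue. f t) \<longlongrightarrow> L) at_top) \<longrightarrow>
            (\<forall>\<psi>\<in>density_class r0.
               ((\<lambda>r. 1 / \<psi> r * (LINT t:{r0<..r}|lebesgue. \<psi> t * f t)) \<longlongrightarrow> 0) at_top))
       \<and> ((\<integral>\<^sup>+t\<in>{r0..}. ennreal \<bar>f t\<bar> \<partial>lebesgue) < \<infinity> \<longrightarrow>
            (\<forall>\<psi>\<in>density_class r0.
               has_limit_in_density r0 \<psi> (\<lambda>r. \<psi> r / deriv \<psi> r * f r) 0))"
  using density_class_weighted_integral(2) has_limit_in_density_0_if_integrable assms(2) by blast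

end
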